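(* Let $(X,\|\cdot\|)$ be a (real or complex) Banach space with a Schauder basis $\{e_n\}_{n\in\mathbb{N}}$ and corresponding coordinate functionals $c_n(\cdot)$, $n\in\mathbb{N}$. For $K\in\mathbb{N}$ and $y\in X$ let $R_K y:=\sum_{k=K+1}^\infty c_k(y)e_k$. Then, for every sequence $(x_n)_{n\in\mathbb{N}}$ in $X$ and every vector $x\in X$, one has $x_n\to x$ in $X$ as $n\to\infty$ if and only if both of the following conditions hold: (1) for every $k\in\mathbb{N}$, $c_k(x_n)\to c_k(x)$ as $n\to\infty$; and (2) for every $\varepsilon>0$ there exists $K_0\in\mathbb{N}$ such that for all $K\ge K_0$ and all $n\in\mathbb{N}$, $\|R_K x_n\|<\varepsilon$.
   Context: $\mathbb{N}=\{1,2,\dots\}$, and $\mathbb{F}=\mathbb{R}$ or $\mathbb{C}$ is the scalar field. A Schauder basis of a Banach space $(X,\|\cdot\|)$ over $\mathbb{F}$ is a countably infinite set $\{e_n\}_{n\in\mathbb{N}}\subset X$ (indexed by $\mathbb{N}$ in a fixed order) such that for every $x\in X$ there is a unique sequence $(c_k(x))_{k\in\mathbb{N}}\in\mathbb{F}^{\mathbb{N}}$ with $x=\sum_{k=1}^\infty c_k(x)e_k$, the series (the Schauder expansion of $x$) being the norm limit of its partial sums $\sum_{k=1}^n c_k(x)e_k$. The numbers $c_k(x)$ are the coordinates of $x$, and the maps $x\mapsto c_k(x)$ are the (linear) coordinate functionals; their continuity is not part of the definition. *)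

theory Defs
  imports "HOL-Analysis.Analysis"
begin

text \<open>
  A Banach space over the scalar field \<open>'k\<close> is a type of class \<^class>\<open>banach\<close> together with a
  scalar multiplication by \<open>'k\<close>. The instances \<open>'k = real\<close> and \<open>'k = complex\<close> are the real
  and the complex Banach spaces; up to isometric isomorphism they are the only ones, since by
  Gelfand-Mazur every complete real normed field with multiplicative norm is the field of real
  or of complex numbers. The last assumption says that the real structure carried
  by the type class is the restriction of scalars of the given one.
\<close>

locale banach_space_over = vector_space smul
  for smul :: "'k::{real_normed_field,banach} \<Rightarrow> 'a::banach \<Rightarrow> 'a" +
  assumes norm_smul: "norm (smul a x) = norm a * norm x"
    and smul_of_real: "smul (of_real r) x = r *\<^sub>R x"

lemma banach_space_over_scaleR:
  "banach_space_over ((*\<^sub>R) :: real \<Rightarrow> 'a::banach \<Rightarrow> 'a)"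
  by unfold_locales (simp_all add: algebra_simps)

lemma banach_space_over_real_unique:
  fixes smul :: "real \<Rightarrow> 'a::banach \<Rightarrow> 'a"
  assumes "banach_space_over smul"
  shows "smul = (*\<^sub>R)"
  using banach_space_over.smul_of_real[OF assms] by (simp add: fun_eq_iff)

lemma banach_space_over_complex:
  "banach_space_over ((*) :: complex \<Rightarrow> complex \<Rightarrow> complex)"
  by unfold_locales (simp_all add: algebra_simps norm_mult scaleR_conv_of_real)

text \<open>
  Indices start at 0: \<open>e k\<close> is the basis vector usually written $e_{k+1}$. Injectivity expresses
  that the basis is a countably infinite set enumerated by \<open>e\<close>.
\<close>

definition schauder_basis ::
    "('k::{real_normed_field,banach} \<Rightarrow> 'a::banach \<Rightarrow> 'a) \<Rightarrow> (nat \<Rightarrow> 'a) \<Rightarrow> bool" where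
  "schauder_basis smul e \<longleftrightarrow> inj e \<and> (\<forall>x. \<exists>!c. (\<lambda>k. smul (c k) (e k)) sums x)"

definition schauder_coord ::
    "('k::{real_normed_field,banach} \<Rightarrow> 'a::banach \<Rightarrow> 'a) \<Rightarrow> (nat \<Rightarrow> 'a) \<Rightarrow> nat \<Rightarrow> 'a \<Rightarrow> 'k" where
  "schauder_coord smul e k x = (THE c. (\<lambda>j. smul (c j) (e j)) sums x) k"

text \<open>
  The expansion of \<open>y\<close> with its first \<open>K\<close> terms removed; with indices starting at 0 these are the
  terms with index less than \<open>K\<close>.
\<close>

definition schauder_remainder ::
    "('k::{real_normed_field,banach} \<Rightarrow> 'a::banach \<Rightarrow> 'a) \<Rightarrow> (nat \<Rightarrow> 'a) \<Rightarrow> nat \<Rightarrow> 'a \<Rightarrow> 'a" where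
  "schauder_remainder smul e K y =
     (\<Sum>k. smul (schauder_coord smul e (K + k) y) (e (K + k)))"

end

theory Submission
  imports Defs
begin

text \<open>
  Everything rests on the uniform boundedness of the partial sum operators. The seminorm
  \<open>x \<mapsto> sup\<^sub>n \<parallel>S\<^sub>n x\<parallel>\<close> is countably subadditive, because uniform convergence in
  \<open>n\<close> lets one add up the Schauder expansions of a series term by term, and by Zabreiko's lemma (a
  Baire category argument) a countably subadditive seminorm on a Banach space is continuous.
  Given a uniform bound for the \<open>S\<^sub>n\<close>, the coordinates and the operators \<open>R\<^sub>K\<close> are
  equicontinuous, and the characterization of convergence is a three-epsilon argument.
\<close>

section \<open>Continuity of countably subadditive seminorms on a Banach space\<close>

theorem zabreiko:
  fixes p :: "'a::banach \<Rightarrow> real"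
  assumes scale: "\<And>r x. p (r *\<^sub>R x) = \<bar>r\<bar> * p x"
    and subadd: "\<And>u. summable u \<Longrightarrow> summable (\<lambda>n. p (u n)) \<Longrightarrow> p (\<Sum>n. u n) \<le> (\<Sum>n. p (u n))"
  shows "\<exists>C\<ge>0. \<forall>x. p x \<le> C * norm x"
proof -
  have p0: "p 0 = 0" using scale[of 0 0] by simp
  have pm: "p (- x) = p x" for x using scale[of "-1" x] by simp
  have add: "p (x + y) \<le> p x + p y" for x y
  proof -
    \<comment> \<open>Ordinary subadditivity is the countable one applied to a two-term series
      padded with zeros, which contribute nothing because \<open>p 0 = 0\<close>.\<close>
    define u where "u = (\<lambda>n::nat. if n = 0 then x else if n = 1 then y else 0)"
    have "u sums (\<Sum>n\<in>{0,1}. u n)" by (rule sums_finite) (auto simp: u_def)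
    then have u: "u sums (x + y)" by (simp add: u_def)
    have "(\<lambda>n. p (u n)) sums (\<Sum>n\<in>{0,1}. p (u n))"
      by (rule sums_finite) (auto simp: u_def p0)
    then have pu: "(\<lambda>n. p (u n)) sums (p x + p y)" by (simp add: u_def)
    show ?thesis
      using subadd[of u] sums_summable[OF u] sums_summable[OF pu] sums_unique[OF u] sums_unique[OF pu]
      by simp
  qed
  have pos: "0 \<le> p x" for x using add[of x "- x"] by (simp add: pm p0)
  define A where "A m = {x. p x \<le> real m}" for m :: nat
  \<comment> \<open>The sets \<open>A m\<close> cover the space, so by Baire their closures cannot
    all have empty interior.\<close>
  have "\<exists>m. interior (closure (A m)) \<noteq> {}"
  proof (rule ccontr)
    assume "\<not> ?thesis"
    then have "Met_TC.mtopology interior_of \<Union> (range (\<lambda>m. closure (A m))) = {}"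
      by (intro Met_TC.metric_Baire_category_alt) (auto simp: complete_UNIV)
    moreover have "\<Union> (range (\<lambda>m. closure (A m))) = UNIV"
    proof -
      have "x \<in> closure (A (nat \<lceil>p x\<rceil>))" for x
        by (rule subsetD[OF closure_subset]) (simp add: A_def real_nat_ceiling_ge)
      then show ?thesis by blast
    qed
    ultimately show False by simp
  qed
  then obtain m z where "z \<in> interior (closure (A m))" by blast
  then obtain r where r: "r > 0" "ball z r \<subseteq> closure (A m)"
    unfolding mem_interior by blast
  \<comment> \<open>Symmetrization moves the ball from \<open>z\<close> to the origin:
    \<open>y\<close> is half the difference of \<open>z + y\<close> and \<open>z - y\<close>, both
    in the closure of \<open>A m\<close>. Half the difference of their approximants still has
    \<open>p\<close> at most \<open>m\<close>.\<close>
  have approx: "\<exists>a. p a \<le> real m \<and> norm (y - a) < d" if y: "norm y < r" and d: "d > 0" for y d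
  proof -
    have "z + y \<in> closure (A m)" "z - y \<in> closure (A m)"
      using r(2) y by (auto simp: subset_iff dist_norm)
    then obtain a b where ab: "p a \<le> m" "dist a (z + y) < d" "p b \<le> m" "dist b (z - y) < d"
      unfolding closure_approachable A_def using d by blast
    let ?c = "(1/2) *\<^sub>R (a + - b)"
    have "p ?c \<le> m"
      using add[of a "- b"] ab by (simp only: scale pm)
    moreover have "norm (y - ?c) < d"
    proof -
      have "y - ?c = (1/2) *\<^sub>R ((z + y - a) - (z - y - b))"
        by (simp add: algebra_simps flip: scaleR_add_left)
      then have "norm (y - ?c) \<le> (1/2) * (norm (z + y - a) + norm (z - y - b))"
        using norm_triangle_ineq4[of "z + y - a" "z - y - b"] by simp
      also have "\<dots> < d"
        using ab by (simp add: dist_norm norm_minus_commute)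
      finally show ?thesis .
    qed
    ultimately show ?thesis by blast
  qed
  have approx_scaled: "\<exists>a. p a \<le> m * t \<and> norm (y - a) < d" if "norm y < r * t" "d > 0" "t > 0" for y and d t :: real
  proof -
    have "norm ((1/t) *\<^sub>R y) < r" "d / t > 0" using that by (auto simp: field_simps)
    from approx[OF this] obtain a where a: "p a \<le> m" "norm ((1/t) *\<^sub>R y - a) < d / t" by blast
    have "y - t *\<^sub>R a = t *\<^sub>R ((1/t) *\<^sub>R y - a)" using that by (simp add: algebra_simps)
    then have "norm (y - t *\<^sub>R a) = t * norm ((1/t) *\<^sub>R y - a)"
      using that(3) by simp
    then have "norm (y - t *\<^sub>R a) < d" using a(2) that(3) by (simp add: field_simps)
    moreover have "p (t *\<^sub>R a) \<le> m * t"
      using a(1) that(3) by (simp add: scale mult.commute)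
    ultimately show ?thesis by blast
  qed
  \<comment> \<open>Successive approximation removes the closure: each correction halves the bound
    on the residual, and the values of \<open>p\<close> on the corrections are dominated by a
    geometric series with sum \<open>2 * m\<close>.\<close>
  have ball: "p y \<le> 2 * m" if y: "norm y < r" for y
  proof -
    \<comment> \<open>The bound on \<open>v\<close> sits inside the existential so that the axiom of
      choice yields a correction \<open>g k v\<close> defined for every \<open>v\<close>.\<close>
    have "\<exists>a. norm v < r * (1/2)^k \<longrightarrow> p a \<le> m * (1/2)^k \<and> norm (v - a) < r * (1/2)^Suc k" for k v
      using approx_scaled[of v "(1/2)^k" "r * (1/2)^Suc k"] r(1)
      by (cases "norm v < r * (1/2)^k") auto
    then have "\<forall>k. \<exists>h. \<forall>v. norm v < r * (1/2)^k \<longrightarrow>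
        p (h v) \<le> m * (1/2)^k \<and> norm (v - h v) < r * (1/2)^Suc k"
      by (intro allI choice)
    from choice[OF this] obtain g where g: "\<And>k v. norm v < r * (1/2)^k \<Longrightarrow>
        p (g k v) \<le> m * (1/2)^k \<and> norm (v - g k v) < r * (1/2)^Suc k"
      by blast
    \<comment> \<open>\<open>u k\<close> is the residual after \<open>k\<close> corrections; since
      it tends to 0, the corrections telescope to \<open>y\<close>.\<close>
    define u where "u = rec_nat y (\<lambda>k v. v - g k v)"
    have u0: "u 0 = y" and uS: "u (Suc k) = u k - g k (u k)" for k
      by (simp_all add: u_def)
    have nu: "norm (u k) < r * (1/2)^k" for k
    proof (induction k)
      case 0 then show ?case using y u0 by simp
    next
      case (Suc k) then show ?case using g uS by simp
    qed
    have "(\<lambda>k. r * (1/2)^k) \<longlonglongrightarrow> 0"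
      by (intro tendsto_mult_right_zero LIMSEQ_realpow_zero) auto
    then have "u \<longlonglongrightarrow> 0"
      by (rule Lim_null_comparison[rotated]) (simp add: less_imp_le[OF nu])
    from telescope_sums'[OF this] have gs: "(\<lambda>k. g k (u k)) sums y"
      by (simp add: uS u0)
    have le: "p (g k (u k)) \<le> m * (1/2)^k" for k using g nu by blast
    have geo: "(\<lambda>k. m * (1/2)^k) sums (real m * 2)"
      using sums_mult[OF geometric_sums[of "1/2::real"], of m] by simp
    have sp: "summable (\<lambda>k. p (g k (u k)))"
      by (rule summable_comparison_test[OF _ sums_summable[OF geo]]) (auto simp: pos le)
    have "p y \<le> (\<Sum>k. p (g k (u k)))"
      using subadd[OF sums_summable[OF gs] sp] sums_unique[OF gs] by simp
    also have "\<dots> \<le> real m * 2"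
      using suminf_le[OF le sp sums_summable[OF geo]] sums_unique[OF geo] by simp
    finally show ?thesis by simp
  qed
  \<comment> \<open>For nonzero \<open>x\<close>, rescaling to norm \<open>r / 2\<close> puts the
    vector inside the ball where \<open>p\<close> is at most \<open>2 * m\<close>; undoing the
    scaling gives the factor \<open>4 * m / r\<close>.\<close>
  have "p x \<le> (4 * m / r) * norm x" for x
  proof (cases "x = 0")
    case False
    let ?t = "r / (2 * norm x)"
    have t: "?t > 0" using False r(1) by simp
    have "norm (?t *\<^sub>R x) < r" using False r(1) by simp
    from ball[OF this] have "?t * p x \<le> 2 * m" using t by (simp only: scale)
    then show ?thesis using False r(1) by (simp add: field_simps)
  qed (simp add: p0)
  moreover have "4 * m / r \<ge> 0" using r(1) by simp
  ultimately show ?thesis by blast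
qed

section \<open>Schauder expansions and the algebra of partial sums\<close>

locale schauder_space = banach_space_over smul
  for smul :: "'k::{real_normed_field,banach} \<Rightarrow> 'a::banach \<Rightarrow> 'a" +
  fixes e :: "nat \<Rightarrow> 'a"
  assumes basis: "schauder_basis smul e"
begin

abbreviation coord :: "nat \<Rightarrow> 'a \<Rightarrow> 'k" where
  "coord \<equiv> schauder_coord smul e"

definition partial_sum :: "nat \<Rightarrow> 'a \<Rightarrow> 'a" where
  "partial_sum n x = (\<Sum>k<n. smul (coord k x) (e k))"

lemma ex1_expansion: "\<exists>!c. (\<lambda>k. smul (c k) (e k)) sums x"
  using basis unfolding schauder_basis_def by blast

lemma coord_sums: "(\<lambda>k. smul (coord k x) (e k)) sums x"
  unfolding schauder_coord_def by (rule theI'[OF ex1_expansion])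

lemma coord_unique:
  assumes "(\<lambda>k. smul (c k) (e k)) sums x"
  shows "coord k x = c k"
  using the1_equality[OF ex1_expansion, OF assms] by (simp add: schauder_coord_def)

lemma coord_add: "coord k (x + y) = coord k x + coord k y"
  using coord_unique[of "\<lambda>k. coord k x + coord k y" "x + y"] sums_add[OF coord_sums coord_sums]
  by (simp add: scale_left_distrib)

lemma coord_scaleR: "coord k (r *\<^sub>R x) = of_real r * coord k x"
  using coord_unique[of "\<lambda>k. of_real r * coord k x" "r *\<^sub>R x"]
    bounded_linear.sums[OF bounded_linear_scaleR_right[of r] coord_sums[of x]]
  by (simp flip: scale_scale add: smul_of_real)

lemma coord_diff: "coord k (x - y) = coord k x - coord k y"
  using coord_add[of k "x - y" y] by simp

text \<open>A zero basis vector could carry any coefficient, so the zero vector would have two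
  expansions.\<close>

lemma basis_nonzero: "e k \<noteq> 0"
proof
  assume "e k = 0"
  then have "coord k 0 = 0" "coord k 0 = 1"
    using coord_unique[of "\<lambda>_. 0" 0 k] coord_unique[of "\<lambda>j. if j = k then 1 else 0" 0 k]
    by (simp_all add: if_distrib[of "\<lambda>a. smul a _"] cong: if_cong)
  then show False by simp
qed

lemma partial_sum_tendsto: "(\<lambda>n. partial_sum n x) \<longlonglongrightarrow> x"
  using coord_sums unfolding sums_def partial_sum_def .

lemma partial_sum_Suc: "partial_sum (Suc n) x = partial_sum n x + smul (coord n x) (e n)"
  by (simp add: partial_sum_def)

lemma partial_sum_add: "partial_sum n (x + y) = partial_sum n x + partial_sum n y"
  by (simp add: partial_sum_def coord_add scale_left_distrib sum.distrib)

lemma partial_sum_scaleR: "partial_sum n (r *\<^sub>R x) = r *\<^sub>R partial_sum n x"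
  by (simp add: partial_sum_def coord_scaleR scaleR_sum_right smul_of_real flip: scale_scale)

lemma partial_sum_diff: "partial_sum n (x - y) = partial_sum n x - partial_sum n y"
  by (simp add: partial_sum_def coord_diff scale_left_diff_distrib sum_subtractf)

lemma partial_sum_sum: "partial_sum n (\<Sum>i<p. f i) = (\<Sum>i<(p::nat). partial_sum n (f i))"
  using partial_sum_scaleR[of n 0 0] by (induction p) (auto simp: partial_sum_add)

section \<open>Uniform boundedness of the partial sum operators\<close>

lemma smul_tendsto:
  assumes "c \<longlonglongrightarrow> d"
  shows "(\<lambda>n. smul (c n) x) \<longlonglongrightarrow> smul d x"
proof -
  have "(\<lambda>n. norm (c n - d) * norm x) \<longlonglongrightarrow> 0"
    using tendsto_mult_left_zero[OF tendsto_norm_zero[OF LIM_zero[OF assms]]] .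
  then have "(\<lambda>n. norm (smul (c n) x - smul d x)) \<longlonglongrightarrow> 0"
    by (simp add: norm_smul flip: scale_left_diff_distrib)
  then show ?thesis by (simp add: tendsto_norm_zero_iff LIM_zero_iff)
qed

text \<open>The line through a nonzero \<open>x\<close> is a copy of the complete scalar field with
  norms scaled by \<open>norm x\<close>, hence closed. This recovers scalar coefficients from limits
  of their multiples of a basis vector.\<close>

lemma smul_limit:
  assumes "(\<lambda>n. smul (c n) x) \<longlonglongrightarrow> y" "x \<noteq> 0"
  shows "\<exists>d. c \<longlonglongrightarrow> d \<and> y = smul d x"
proof -
  have "Cauchy c"
  proof (rule CauchyI)
    fix \<epsilon> :: real assume "\<epsilon> > 0"
    then have "\<epsilon> * norm x > 0" using assms(2) by simp
    from CauchyD[OF LIMSEQ_imp_Cauchy[OF assms(1)] this]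
    show "\<exists>M. \<forall>m\<ge>M. \<forall>n\<ge>M. norm (c m - c n) < \<epsilon>"
      using assms(2) by (simp add: norm_smul flip: scale_left_diff_distrib)
  qed
  then obtain d where "c \<longlonglongrightarrow> d" using Cauchy_convergent_iff convergentD by blast
  with LIMSEQ_unique[OF assms(1) smul_tendsto] show ?thesis by blast
qed

text \<open>The majorant \<open>M\<close> makes the series converge uniformly in \<open>n\<close>.
  Its sums \<open>s n\<close> therefore tend to \<open>x\<close>, and they turn out to be partial
  sums of a series of multiples of the basis vectors; uniqueness of the expansion identifies them
  with those of \<open>x\<close>. Continuity of the coordinates is never presupposed.\<close>

lemma partial_sum_series:
  assumes u: "u sums x"
    and M: "\<And>i n. norm (partial_sum n (u i)) \<le> M i" "summable M"
  shows "(\<lambda>i. partial_sum n (u i)) sums partial_sum n x"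
proof -
  define s where "s n = (\<Sum>i. partial_sum n (u i))" for n
  define v where "v q = (\<Sum>i<q. u i)" for q
  have "uniform_limit UNIV (\<lambda>q n. \<Sum>i<q. partial_sum n (u i)) s sequentially"
    unfolding s_def by (rule Weierstrass_m_test) (use M in auto)
  then have lim: "uniform_limit UNIV (\<lambda>q n. partial_sum n (v q)) s sequentially"
    by (simp add: partial_sum_sum v_def)
  have lim_n: "(\<lambda>q. partial_sum n (v q)) \<longlonglongrightarrow> s n" for n
    using tendsto_uniform_limitI[OF lim] by blast
  \<comment> \<open>Interchange of limits: for fixed \<open>q\<close> the partial sums tend to
    \<open>v q\<close> as \<open>n\<close> grows, \<open>v q\<close> tends to \<open>x\<close>, and
    the convergence in \<open>q\<close> is uniform in \<open>n\<close>.\<close>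
  have "s \<longlonglongrightarrow> x"
  proof (rule swap_uniform_limit'[OF _ _ lim])
    show "\<forall>\<^sub>F q in sequentially. (\<lambda>n. partial_sum n (v q)) \<longlonglongrightarrow> v q"
      by (simp add: partial_sum_tendsto)
    show "v \<longlonglongrightarrow> x" using u unfolding sums_def v_def .
  qed auto
  \<comment> \<open>Each increment of \<open>s\<close> is a limit of multiples of
    \<open>e k\<close>, hence itself such a multiple; this produces the coefficients
    \<open>d k\<close>.\<close>
  have "(\<lambda>q. smul (coord k (v q)) (e k)) \<longlonglongrightarrow> s (Suc k) - s k" for k
    using tendsto_diff[OF lim_n[of "Suc k"] lim_n[of k]] by (simp add: partial_sum_Suc)
  from smul_limit[OF this basis_nonzero] have "\<exists>d. s (Suc k) - s k = smul d (e k)" for k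
    by blast
  then obtain d where d: "\<And>k. s (Suc k) - s k = smul (d k) (e k)" by metis
  have "s 0 = 0" by (simp add: s_def partial_sum_def)
  then have s: "s n = (\<Sum>k<n. smul (d k) (e k))" for n
    by (simp add: sum_lessThan_telescope flip: d)
  then have "s = (\<lambda>n. \<Sum>k<n. smul (d k) (e k))" by (rule ext)
  with \<open>s \<longlonglongrightarrow> x\<close> have "coord k x = d k" for k
    by (intro coord_unique) (simp add: sums_def)
  then have "s n = partial_sum n x" by (simp add: s partial_sum_def)
  then show ?thesis
    using lim_n[of n] by (simp add: sums_def partial_sum_sum v_def)
qed

text \<open>The supremum \<open>p\<close> of the norms of the partial sums is finite because
  convergent sequences are bounded. Term-by-term summation makes it countably subadditive, so
  \<open>zabreiko\<close> applies.\<close>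

lemma partial_sums_uniformly_bounded:
  "\<exists>C\<ge>0. \<forall>n x. norm (partial_sum n x) \<le> C * norm x"
proof -
  define p where "p x = (SUP n. norm (partial_sum n x))" for x
  have bdd: "bdd_above (range (\<lambda>n. norm (partial_sum n x)))" for x
  proof -
    have "Bseq (\<lambda>n. partial_sum n x)"
      using partial_sum_tendsto by (intro convergent_imp_Bseq convergentI)
    then show ?thesis by (auto simp: Bseq_def bdd_above_def)
  qed
  have p_upper: "norm (partial_sum n x) \<le> p x" for n x
    unfolding p_def by (rule cSUP_upper[OF _ bdd]) simp
  have p_least: "p x \<le> C" if "\<And>n. norm (partial_sum n x) \<le> C" for x C
    unfolding p_def by (rule cSUP_least) (use that in auto)
  have scale_le: "p (r *\<^sub>R x) \<le> \<bar>r\<bar> * p x" for r x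
    by (rule p_least) (simp add: partial_sum_scaleR mult_left_mono p_upper)
  have p_nonneg: "0 \<le> p x" for x using p_upper[of 0 x] norm_ge_zero order_trans by blast
  have "p (r *\<^sub>R x) = \<bar>r\<bar> * p x" for r x
  proof (cases "r = 0")
    case True
    then show ?thesis using scale_le[of 0 0] p_nonneg[of 0] by simp
  next
    case False
    then have "\<bar>r\<bar> * p x \<le> p (r *\<^sub>R x)"
      using scale_le[of "1 / r" "r *\<^sub>R x"] by (simp add: field_simps)
    then show ?thesis using scale_le by (rule antisym[rotated])
  qed
  moreover have "p (\<Sum>n. u n) \<le> (\<Sum>n. p (u n))" if u: "summable u" "summable (\<lambda>n. p (u n))" for u
  proof (rule p_least)
    fix n
    have "norm (partial_sum n (\<Sum>n. u n)) = norm (\<Sum>i. partial_sum n (u i))"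
      using partial_sum_series[OF summable_sums[OF u(1)] p_upper u(2)] by (simp add: sums_iff)
    also have "\<dots> \<le> (\<Sum>i. p (u i))"
      by (rule norm_suminf_le[OF p_upper u(2)])
    finally show "norm (partial_sum n (\<Sum>n. u n)) \<le> (\<Sum>i. p (u i))" .
  qed
  ultimately obtain C where "C \<ge> 0" "\<And>x. p x \<le> C * norm x"
    using zabreiko[of p] by blast
  then show ?thesis using p_upper order_trans by metis
qed

section \<open>Convergence of vectors, coordinates and remainders\<close>

lemma partial_sum_tendsto_arg:
  assumes "X \<longlonglongrightarrow> x"
  shows "(\<lambda>n. partial_sum k (X n)) \<longlonglongrightarrow> partial_sum k x"
proof -
  obtain C where C: "\<And>n x. norm (partial_sum n x) \<le> C * norm x"
    using partial_sums_uniformly_bounded by blast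
  have "(\<lambda>n. C * norm (X n - x)) \<longlonglongrightarrow> 0"
    using tendsto_mult_right_zero[OF tendsto_norm_zero[OF LIM_zero[OF assms]]] .
  then have "(\<lambda>n. partial_sum k (X n) - partial_sum k x) \<longlonglongrightarrow> 0"
    by (rule Lim_null_comparison[rotated]) (simp add: C flip: partial_sum_diff)
  then show ?thesis by (rule LIM_zero_cancel)
qed

text \<open>Consecutive partial sums differ by one term of the expansion, so continuity passes from
  partial sums to coordinates once the nonzero vector \<open>e k\<close> is cancelled.\<close>

lemma coord_tendsto:
  assumes "X \<longlonglongrightarrow> x"
  shows "(\<lambda>n. coord k (X n)) \<longlonglongrightarrow> coord k x"
proof -
  have "(\<lambda>n. smul (coord k (X n)) (e k)) \<longlonglongrightarrow> smul (coord k x) (e k)"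
    using tendsto_diff[OF partial_sum_tendsto_arg[OF assms, of "Suc k"] partial_sum_tendsto_arg[OF assms, of k]]
    by (simp add: partial_sum_Suc)
  from smul_limit[OF this basis_nonzero] show ?thesis
    using basis_nonzero[of k] by auto
qed

lemma remainder_eq: "schauder_remainder smul e K y = y - partial_sum K y"
proof -
  have "(\<lambda>k. smul (coord (k + K) y) (e (k + K))) sums (y - partial_sum K y)"
    unfolding partial_sum_def using sums_split_initial_segment[OF coord_sums] .
  then show ?thesis
    by (simp add: schauder_remainder_def sums_iff add.commute)
qed

text \<open>The finitely many early terms are handled one by one by convergence of their expansions.
  A late term is \<open>x\<close> plus a small vector, on which the remainder is controlled by
  \<open>1 + C\<close> uniformly in \<open>K\<close>.\<close>

lemma remainder_uniformly_small:
  assumes "X \<longlonglongrightarrow> x" "\<epsilon> > 0"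
  shows "\<exists>K\<^sub>0\<ge>1. \<forall>K\<ge>K\<^sub>0. \<forall>n. norm (schauder_remainder smul e K (X n)) < \<epsilon>"
proof -
  obtain C where C: "C \<ge> 0" "\<And>n x. norm (partial_sum n x) \<le> C * norm x"
    using partial_sums_uniformly_bounded by blast
  have small: "\<forall>\<^sub>F K in sequentially. norm (y - partial_sum K y) < \<delta>" if "\<delta> > 0" for y and \<delta> :: real
    using tendstoD[OF partial_sum_tendsto[of y] that] by (simp add: dist_norm norm_minus_commute)
  \<comment> \<open>Chosen so that \<open>(1 + C) * ?\<delta>\<close> equals
    \<open>\<epsilon> / 2\<close>; the summand 1 comes from the identity in
    \<open>y - partial_sum K y\<close> and keeps the denominator positive when
    \<open>C = 0\<close>.\<close>
  let ?\<delta> = "\<epsilon> / (2 * (1 + C))"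
  have "?\<delta> > 0" using C(1) assms(2) by simp
  from LIMSEQ_D[OF assms(1) this] obtain N where N: "\<And>n. n \<ge> N \<Longrightarrow> norm (X n - x) < ?\<delta>" by blast
  have "\<forall>\<^sub>F K in sequentially. \<forall>n\<in>{..<N}. norm (X n - partial_sum K (X n)) < \<epsilon>"
    by (intro eventually_ball_finite) (auto intro: small assms(2))
  moreover have "\<forall>\<^sub>F K in sequentially. norm (x - partial_sum K x) < \<epsilon> / 2"
    using assms(2) by (intro small) simp
  moreover have "\<forall>\<^sub>F K in sequentially. K \<ge> (1::nat)" by (rule eventually_ge_at_top)
  ultimately have "\<forall>\<^sub>F K in sequentially. \<forall>n. norm (X n - partial_sum K (X n)) < \<epsilon>"
  proof eventually_elim
    case (elim K)
    show ?case
    proof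
      fix n
      show "norm (X n - partial_sum K (X n)) < \<epsilon>"
      proof (cases "n < N")
        case False
        let ?h = "X n - x"
        have "X n - partial_sum K (X n) = (x - partial_sum K x) + (?h - partial_sum K ?h)"
          by (simp add: partial_sum_diff)
        then have "norm (X n - partial_sum K (X n))
            \<le> norm (x - partial_sum K x) + norm (?h - partial_sum K ?h)"
          by (metis norm_triangle_ineq)
        moreover have "norm (?h - partial_sum K ?h) \<le> (1 + C) * norm ?h"
          using norm_triangle_ineq4[of ?h "partial_sum K ?h"] C(2)[of K ?h]
          by (simp add: distrib_right)
        moreover have "(1 + C) * norm ?h < \<epsilon> / 2"
          using N[of n] False C(1) by (simp add: field_simps)
        ultimately show ?thesis using elim(2) by linarith
      qed (use elim(1) in simp)
    qed
  qed
  then obtain K0 where "\<And>K n. K \<ge> K0 \<Longrightarrow> norm (X n - partial_sum K (X n)) < \<epsilon>"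
    unfolding eventually_sequentially by blast
  then show ?thesis
    \<comment> \<open>The maximum with 1 meets the requirement that the threshold be a positive
      integer.\<close>
    by (intro exI[of _ "max 1 K0"]) (simp add: remainder_eq)
qed

text \<open>Two of the three errors are tails, made small by fixing one cutoff for \<open>x\<close>
  and all \<open>X n\<close> at once. The third is a finite sum with that fixed number of terms, so
  coordinatewise convergence controls it.\<close>

lemma tendsto_if_coord_tendsto:
  assumes coord: "\<And>k. (\<lambda>n. coord k (X n)) \<longlonglongrightarrow> coord k x"
    and tail: "\<And>\<epsilon>. \<epsilon> > 0 \<Longrightarrow>
      \<exists>K\<^sub>0. \<forall>K\<ge>K\<^sub>0. \<forall>n. norm (schauder_remainder smul e K (X n)) < \<epsilon>"
  shows "X \<longlonglongrightarrow> x"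
proof (rule LIMSEQ_I)
  fix \<epsilon> :: real assume "\<epsilon> > 0"
  then have \<epsilon>: "\<epsilon> / 3 > 0" by simp
  from tail[OF \<epsilon>] obtain K0 where
    K0: "\<And>K n. K \<ge> K0 \<Longrightarrow> norm (X n - partial_sum K (X n)) < \<epsilon> / 3"
    by (auto simp: remainder_eq)
  from LIMSEQ_D[OF partial_sum_tendsto \<epsilon>, of x] obtain K1 where
    K1: "\<And>K. K \<ge> K1 \<Longrightarrow> norm (partial_sum K x - x) < \<epsilon> / 3" by blast
  let ?K = "max K0 K1"
  have "(\<lambda>n. partial_sum ?K (X n)) \<longlonglongrightarrow> partial_sum ?K x"
    unfolding partial_sum_def by (intro tendsto_sum smul_tendsto coord)
  from LIMSEQ_D[OF this \<epsilon>] obtain N where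
    N: "\<And>n. n \<ge> N \<Longrightarrow> norm (partial_sum ?K (X n) - partial_sum ?K x) < \<epsilon> / 3" by blast
  have "norm (X n - x) < \<epsilon>" if "n \<ge> N" for n
  proof -
    have "X n - x = (X n - partial_sum ?K (X n)) + (partial_sum ?K (X n) - partial_sum ?K x)
        + (partial_sum ?K x - x)" by simp
    then have "norm (X n - x) \<le> norm (X n - partial_sum ?K (X n))
        + norm (partial_sum ?K (X n) - partial_sum ?K x) + norm (partial_sum ?K x - x)"
      by (metis norm_triangle_mono norm_triangle_ineq order_refl)
    then show ?thesis using K0[of ?K n] K1[of ?K] N[OF that] by simp
  qed
  then show "\<exists>N. \<forall>n\<ge>N. norm (X n - x) < \<epsilon>" by blast
qed

end

theorem theorem3p1:
  fixes smul :: "'k::{real_normed_field,banach} \<Rightarrow> 'a::banach \<Rightarrow> 'a"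
    and e :: "nat \<Rightarrow> 'a" and X :: "nat \<Rightarrow> 'a" and x :: 'a
  assumes "banach_space_over smul"
    and "schauder_basis smul e"
  shows "X \<longlonglongrightarrow> x \<longleftrightarrow>
    (\<forall>k. (\<lambda>n. schauder_coord smul e k (X n)) \<longlonglongrightarrow> schauder_coord smul e k x) \<and>
    (\<forall>\<epsilon>>0. \<exists>K\<^sub>0\<ge>1. \<forall>K\<ge>K\<^sub>0. \<forall>n. norm (schauder_remainder smul e K (X n)) < \<epsilon>)"
proof -
  interpret schauder_space smul e
    using assms by (simp add: schauder_space_def schauder_space_axioms_def)
  show ?thesis
    using coord_tendsto[of X x] remainder_uniformly_small[of X x] tendsto_if_coord_tendsto[of X x]
    by blast
qed

end
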